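(* Fix $\kappa\in\mathbb{N}$ (and $b\in(0,\infty)$). Then, for any $p\in(0,\infty)$ and for any $s$ in some neighbourhood of $s_p$: (i) if $p<p_*$, then $\big[s<s_p\Rightarrow a_p(s)<a_p(s_p)\big]$ and $\big[s>s_p\Rightarrow a_p(s)>a_p(s_p)\big]$; (ii) if $p>p_*$, then $\big[s<s_p\Rightarrow a_p(s)>a_p(s_p)\big]$ and $\big[s>s_p\Rightarrow a_p(s)<a_p(s_p)\big]$. Furthermore, for $p=p_*$, for any $s\in[0,p_*b]\setminus\{s_{p_*}\}$, we have $a_{p_*}(s)>a_{p_*}(s_{p_*})$.
   Context: Notation. $\mathbb{N}_0=\{0,1,2,\dots\}$; $\mathcal M_1(\mathbb{N}_0)$ is the set of probability measures on $\mathbb{N}_0$; $\mathrm{Poi}_\alpha(k)=e^{-\alpha}\alpha^k/k!$; $H(\mu|\nu)=\sum_k\mu_k\log\frac{\mu_k}{\nu_k}$ (relative entropy). For $p\in(0,\infty)$ let $$I^{(p)}_{\mathrm{L,IB}}(a,s,r)=\inf\Big\{H(\mu|\mathrm{Poi}_{bp})\colon\mu\in\mathcal M_1(\mathbb{N}_0),\ \sum_{k\in\mathbb{N}_0}k\mu_k=a,\ \sum_{k\le\kappa}k\mu_k=s,\ \sum_{k\le\kappa}\mu_k=r\Big\}.$$ This is the large-deviation rate function of $\frac1N$ times (number of attempts, number of successes, number of successful slots) in the following slotted ALOHA model: there are $bN$ participants and $N$ time slots, in each slot each participant independently makes a transmission attempt with probability $p/N$, and all attempts in a slot are successful if their number is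 at most $\kappa$, and otherwise all of them are unsuccessful. For given $p$ and $s$, $a_p(s)$ denotes a minimizer of the map $a\mapsto\inf_r I^{(p)}_{\mathrm{L,IB}}(a,s,r)$, i.e., the typical rate of sending attempts, conditional on having approximately $sN$ successes. $s_p=e^{-bp}\sum_{i=0}^{\kappa}i\frac{(bp)^i}{i!}=bp\,e^{-bp}\sum_{i=0}^{\kappa-1}\frac{(bp)^i}{i!}$ is the $s$-component of the unique minimizer of $I^{(p)}_{\mathrm{L,IB}}$. $p_*\in(0,\infty)$ denotes the unique maximizer of $(0,\infty)\ni p\mapsto s_p$; it is characterised by $\frac{(a_* )^\kappa}{(\kappa-1)!}=\sum_{i=0}^{\kappa-1}\frac{(a_* )^i}{i!}$ with $a_*=bp_*$.
   Formalization: The final claim (p = p_* ) is stated only for κ ≥ 2; for κ = 1 it is false, since then a_{p_*}(s) = 1 for every s in [0, p_*b] and the strict inequality fails. *)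

theory Defs
  imports "HOL-Probability.Probability"
begin

text \<open>
  Relative entropy on the natural numbers, with values in \<open>[0, \<infinity>]\<close>. The library's
  \<open>KL_divergence\<close> is real-valued and equals \<open>0\<close> where the defining integral diverges, so the
  series is written out here. The conventions are \<open>0 log 0 = 0\<close> (automatic, as \<open>0 * ln 0 = 0\<close>)
  and value \<open>\<infinity>\<close> if \<open>\<mu>\<close> is not absolutely continuous with respect to \<open>\<nu>\<close>. Because
  \<open>t log t \<ge> -1/e\<close>, the negative parts of the terms always have a finite sum, so a series that
  is not summable diverges to \<open>\<infinity>\<close>.
\<close>

definition rel_entropy :: "nat pmf \<Rightarrow> nat pmf \<Rightarrow> ereal" where
  "rel_entropy \<mu> \<nu> =
     (if set_pmf \<mu> \<subseteq> set_pmf \<nu> \<and> summable (\<lambda>k. pmf \<mu> k * ln (pmf \<mu> k / pmf \<nu> k))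
      then ereal (\<Sum>k. pmf \<mu> k * ln (pmf \<mu> k / pmf \<nu> k))
      else \<infinity>)"

text \<open>The infimum over the empty set is \<open>\<infinity>\<close>.\<close>

definition rate_IB :: "nat \<Rightarrow> real \<Rightarrow> real \<Rightarrow> real \<Rightarrow> real \<Rightarrow> real \<Rightarrow> ereal" where
  "rate_IB \<kappa> b p a s r =
     Inf {rel_entropy \<mu> (poisson_pmf (b * p)) | \<mu>.
            (\<lambda>k. real k * pmf \<mu> k) sums a \<and>
            (\<Sum>k\<le>\<kappa>. real k * pmf \<mu> k) = s \<and>
            (\<Sum>k\<le>\<kappa>. pmf \<mu> k) = r}"

definition is_attempt_rate :: "nat \<Rightarrow> real \<Rightarrow> real \<Rightarrow> real \<Rightarrow> real \<Rightarrow> bool" where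
  "is_attempt_rate \<kappa> b p s a \<longleftrightarrow>
     is_arg_min (\<lambda>a. INF r. rate_IB \<kappa> b p a s r) (\<lambda>_. True) a"

definition s_typ :: "nat \<Rightarrow> real \<Rightarrow> real \<Rightarrow> real" where
  "s_typ \<kappa> b p = exp (- (b * p)) * (\<Sum>i\<le>\<kappa>. real i * (b * p) ^ i / fact i)"

definition p_star :: "nat \<Rightarrow> real \<Rightarrow> real" where
  "p_star \<kappa> b = (THE p. is_arg_max (s_typ \<kappa> b) (\<lambda>p. 0 < p) p)"

end

theory Submission
  imports Defs
begin

text \<open>
  Put \<open>l = b p\<close> and let \<open>q\<close> be the Poisson law with mean \<open>l\<close>. Minimising over \<open>a\<close> and \<open>r\<close> leaves one
  constraint, \<open>\<Sum>k\<le>\<kappa>. k \<mu>(k) = s\<close>, so the optimal \<open>\<mu>\<close> is an exponential tilt of \<open>q\<close> on \<open>{0..\<kappa>}\<close>: it is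
  proportional to \<open>q(k) x^k\<close> for \<open>k \<le> \<kappa>\<close> and to \<open>q(k)\<close> for \<open>k > \<kappa>\<close>, where \<open>x \<ge> 0\<close> is fixed by \<open>s\<close>. The value
  \<open>x = 1\<close> is the untilted law, with mean \<open>l\<close> and \<open>s = s_typ\<close>. Let \<open>successes x\<close> and \<open>attempts x\<close> be the
  truncated and the full mean of the tilt. By \<open>is_attempt_rate_iff\<close>, \<open>attempts x\<close> is the only
  minimiser for \<open>s = successes x\<close>, and everything reduces to comparing \<open>attempts x\<close> with \<open>l\<close>.

  The mean of the tilt exceeds \<open>l\<close> exactly when
  \<open>excess x = \<Sum>k\<le>\<kappa>. (k - l) q(k) (x^k - 1)\<close> is positive. This function vanishes at \<open>x = 1\<close>, and its
  derivative there is \<open>\<Sum>k\<le>\<kappa>. k (k - l) q(k)\<close>, the covariance under \<open>q\<close> of the attempts and the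
  successes in a slot. The same sum is \<open>l\<close> times the derivative of \<open>s_typ\<close> as a function of \<open>l\<close>
  (\<open>DERIV_typical_successes\<close>): the score function of the Poisson family is \<open>(k - l) / l\<close>. Hence
  the covariance is positive below \<open>p_*\<close>, zero at \<open>p_*\<close> and negative above it
  (\<open>attempt_success_cov_sign_change\<close>, \<open>is_arg_max_s_typ\<close>). Since \<open>successes x\<close> lies on the same side of
  \<open>s_typ\<close> as \<open>x\<close> of \<open>1\<close>, the local statements follow.

  At \<open>p_*\<close>, for \<open>\<kappa> \<ge> 2\<close>, the coefficients of \<open>x excess'(x)\<close> add up to \<open>0\<close> and change sign once, from negative to
  positive, because \<open>l < \<kappa>\<close>. So \<open>excess\<close> decreases on \<open>[0, 1]\<close> and increases afterwards, and its
  minimum \<open>0\<close> is attained only at \<open>x = 1\<close> (\<open>excess_pos_critical\<close>). Every \<open>s\<close> in \<open>[0, \<kappa>)\<close> is of the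
  form \<open>successes x\<close>, which makes the comparison global. For \<open>\<kappa> = 1\<close> one has \<open>l = 1\<close> at \<open>p_*\<close>, and
  \<open>excess\<close> vanishes identically.
\<close>

section \<open>The Gibbs inequality\<close>

text \<open>
  Relative entropy with respect to the normalised weight \<open>q v / Z\<close> is nonnegative; written out, this
  bounds the entropy relative to \<open>q\<close> from below. The weight may vanish, as long as \<open>\<mu>\<close> vanishes there
  too; this covers the boundary tilt \<open>x = 0\<close>.
\<close>

lemma gibbs_inequality:
  fixes \<mu> q v :: "nat \<Rightarrow> real"
  assumes \<mu>: "\<And>k. 0 \<le> \<mu> k" "\<mu> sums 1" and q: "\<And>k. 0 < q k"
    and v: "\<And>k. 0 \<le> v k" "\<And>k. v k = 0 \<Longrightarrow> \<mu> k = 0"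
    and Z: "(\<lambda>k. q k * v k) sums Z" "0 < Z"
    and h: "(\<lambda>k. \<mu> k * ln (\<mu> k / q k)) sums h"
    and L: "(\<lambda>k. \<mu> k * ln (v k)) sums L"
  shows "L - ln Z \<le> h"
proof -
  have term_le: "\<mu> k * ln (v k) - \<mu> k * ln Z + (\<mu> k - q k * v k / Z) \<le> \<mu> k * ln (\<mu> k / q k)" for k
  proof (cases "\<mu> k = 0")
    case True
    then show ?thesis using q[of k] v(1)[of k] Z(2) by simp
  next
    case False
    then have pos: "0 < \<mu> k" "0 < v k" using \<mu>(1)[of k] v(1)[of k] v(2)[of k] by force+
    let ?u = "q k * v k / (Z * \<mu> k)"
    have "ln ?u \<le> ?u - 1" using pos q[of k] Z(2) by (intro ln_le_minus_one) simp
    moreover have "ln ?u = ln (v k) - ln Z - ln (\<mu> k / q k)"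
      using pos q[of k] Z(2) by (simp add: ln_div ln_mult)
    ultimately have "\<mu> k * (ln (v k) - ln Z - ln (\<mu> k / q k)) \<le> \<mu> k * (?u - 1)"
      using pos by (intro mult_left_mono) auto
    also have "\<mu> k * (?u - 1) = q k * v k / Z - \<mu> k"
      using pos Z(2) by (simp add: field_simps)
    finally show ?thesis by (simp add: algebra_simps)
  qed
  have "(\<lambda>k. \<mu> k * ln (v k) - \<mu> k * ln Z + (\<mu> k - q k * v k / Z)) sums (L - 1 * ln Z + (1 - Z / Z))"
    by (intro sums_add sums_diff L sums_mult2 \<mu>(2) sums_divide Z(1))
  from sums_le[OF term_le this h] show ?thesis using Z(2) by simp
qed

section \<open>Tilted Poisson laws\<close>

definition pois :: "real \<Rightarrow> nat \<Rightarrow> real" where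
  "pois l k = l ^ k / fact k * exp (- l)"

text \<open>
  The density of the tilted law before normalisation. The parameter \<open>x\<close> is dual to the number of
  successes; it is kept as a base instead of an exponent so that \<open>x = 0\<close>, which belongs to \<open>s = 0\<close>, is
  included. The parameter \<open>t\<close> is dual to the number of attempts; the optimal laws have \<open>t = 0\<close>,
  and small \<open>t \<noteq> 0\<close> only serve to show that the optimal mean is unique.
\<close>

definition tilt :: "nat \<Rightarrow> real \<Rightarrow> real \<Rightarrow> nat \<Rightarrow> real" where
  "tilt \<kappa> x t k = exp (t * real k) * (if k \<le> \<kappa> then x ^ k else 1)"

text \<open>
  The normalising constant of the tilted law. The infinite tail is eliminated by starting from the
  untruncated sum and correcting the finitely many terms with \<open>k \<le> \<kappa>\<close>; the mean in \<open>attempts\<close> below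
  is written in the same way.
\<close>

definition mass :: "nat \<Rightarrow> real \<Rightarrow> real \<Rightarrow> real \<Rightarrow> real" where
  "mass \<kappa> l x t = exp (l * (exp t - 1)) + (\<Sum>k\<le>\<kappa>. pois l k * exp (t * real k) * (x ^ k - 1))"

definition successes :: "nat \<Rightarrow> real \<Rightarrow> real \<Rightarrow> real" where
  "successes \<kappa> l x = (\<Sum>k\<le>\<kappa>. real k * pois l k * x ^ k) / mass \<kappa> l x 0"

definition attempts :: "nat \<Rightarrow> real \<Rightarrow> real \<Rightarrow> real" where
  "attempts \<kappa> l x = (l + (\<Sum>k\<le>\<kappa>. real k * pois l k * (x ^ k - 1))) / mass \<kappa> l x 0"

lemma pois_pos: "0 < l \<Longrightarrow> 0 < pois l k"
  by (simp add: pois_def)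

lemma pmf_poisson_pois: "0 < l \<Longrightarrow> pmf (poisson_pmf l) k = pois l k"
  by (simp add: pois_def)

lemma pois_exp_sums: "(\<lambda>k. pois l k * exp (t * real k)) sums exp (l * (exp t - 1))"
proof -
  have "(\<lambda>k. (l * exp t) ^ k / fact k * exp (- l)) sums (exp (l * exp t) * exp (- l))"
    using exp_converges[of "l * exp t"] by (intro sums_mult2) (simp add: scaleR_conv_of_real field_simps)
  then show ?thesis
    by (simp add: pois_def power_mult_distrib exp_of_nat_mult[symmetric] mult_ac
          flip: exp_add) (simp add: algebra_simps)
qed

lemma pois_sums: "pois l sums 1"
  using pois_exp_sums[of l 0] by simp

lemma pois_Suc: "real (Suc k) * pois l (Suc k) = l * pois l k"
  by (simp add: pois_def divide_simps del: of_nat_Suc)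

lemma pois_mean_sums: "(\<lambda>k. real k * pois l k) sums l"
proof -
  have "(\<lambda>k. l * pois l k) sums (l * 1)" by (intro sums_mult pois_sums)
  then have "(\<lambda>k. real (Suc k) * pois l (Suc k)) sums l" by (simp only: pois_Suc) simp
  from sums_Suc[OF this] show ?thesis by simp
qed

lemma tilt_nonneg: "0 \<le> x \<Longrightarrow> 0 \<le> tilt \<kappa> x t k"
  by (simp add: tilt_def)

lemma truncated_sums: "(\<lambda>k. if k \<le> \<kappa> then f k else 0) sums (\<Sum>k\<le>\<kappa>. f k)"
  for f :: "nat \<Rightarrow> real"
  using sums_If_finite_set[of "{..\<kappa>}" f] by simp

lemma tilted_pois_sums: "(\<lambda>k. pois l k * tilt \<kappa> x t k) sums mass \<kappa> l x t"
proof -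
  have "pois l k * tilt \<kappa> x t k = pois l k * exp (t * real k)
      + (if k \<le> \<kappa> then pois l k * exp (t * real k) * (x ^ k - 1) else 0)" for k
    by (simp add: tilt_def algebra_simps)
  then show ?thesis
    unfolding mass_def using sums_add[OF pois_exp_sums[of l t] truncated_sums] by simp
qed

lemma mass_pos:
  assumes "0 < l" "0 \<le> x"
  shows "0 < mass \<kappa> l x t"
proof -
  have "0 < (\<Sum>k. pois l k * tilt \<kappa> x t k)"
  proof (rule suminf_pos2[where i = "Suc \<kappa>"])
    show "summable (\<lambda>k. pois l k * tilt \<kappa> x t k)" using tilted_pois_sums sums_summable by blast
    show "0 \<le> pois l k * tilt \<kappa> x t k" for k
      using pois_pos[OF assms(1), of k] tilt_nonneg[OF assms(2)] by simp
    show "0 < pois l (Suc \<kappa>) * tilt \<kappa> x t (Suc \<kappa>)"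
      using pois_pos[OF assms(1)] by (simp add: tilt_def)
  qed
  then show ?thesis using tilted_pois_sums by (simp add: sums_iff)
qed

lemma mass_0: "mass \<kappa> l x 0 = 1 + (\<Sum>k\<le>\<kappa>. pois l k * (x ^ k - 1))"
  by (simp add: mass_def)

lemma sum_pois_less_1: "0 < l \<Longrightarrow> (\<Sum>k\<le>\<kappa>. pois l k) < 1"
  using sum_less_suminf[of "pois l" "Suc \<kappa>"] pois_sums[of l] pois_pos[of l]
  by (simp add: sums_iff lessThan_Suc_atMost)

lemma at_1: "attempts \<kappa> l 1 = l" "successes \<kappa> l 1 = (\<Sum>k\<le>\<kappa>. real k * pois l k)"
  by (simp_all add: attempts_def successes_def mass_0)

lemma s_typ_successes: "s_typ \<kappa> b p = successes \<kappa> (b * p) 1"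
  by (simp add: s_typ_def at_1 pois_def sum_distrib_left mult_ac)

text \<open>
  As usual for exponential families, the derivative of the logarithm of the normalising constant in
  the parameter dual to the attempts is the mean number of attempts.
\<close>

lemma DERIV_mass: "((\<lambda>t. mass \<kappa> l x t) has_real_derivative
    l + (\<Sum>k\<le>\<kappa>. real k * pois l k * (x ^ k - 1))) (at 0)"
  unfolding mass_def
  by (auto intro!: derivative_eq_intros sum.cong simp: mult_ac)

section \<open>The attempt rate\<close>

text \<open>
  Every tilt gives a lower bound on the rate: against a law \<open>\<mu>\<close> with the prescribed means, the logarithm
  of the tilting density integrates to \<open>t a + s ln x\<close>. For \<open>x = 0\<close> the constraint \<open>s = 0\<close> forces
  \<open>\<mu>\<close> to vanish on \<open>{1..\<kappa>}\<close>, and the value \<open>ln 0 = 0\<close> makes the formula correct in this case as well.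
\<close>

lemma rate_IB_ge:
  assumes "0 < b * p" and x: "0 \<le> x" "x = 0 \<Longrightarrow> s = 0"
  shows "ereal (t * a + s * ln x - ln (mass \<kappa> (b * p) x t)) \<le> rate_IB \<kappa> b p a s r"
  unfolding rate_IB_def
proof (rule Inf_greatest, clarify)
  fix \<mu> :: "nat pmf"
  assume a: "(\<lambda>k. real k * pmf \<mu> k) sums a" and s: "s = (\<Sum>k\<le>\<kappa>. real k * pmf \<mu> k)"
  let ?l = "b * p"
  show "ereal (t * a + (\<Sum>k\<le>\<kappa>. real k * pmf \<mu> k) * ln x - ln (mass \<kappa> ?l x t))
      \<le> rel_entropy \<mu> (poisson_pmf ?l)"
  proof (cases "summable (\<lambda>k. pmf \<mu> k * ln (pmf \<mu> k / pois ?l k))")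
    case True
    have zero: "pmf \<mu> k = 0" if "x = 0" "k \<le> \<kappa>" "0 < k" for k
    proof -
      have "\<forall>j\<in>{..\<kappa>}. real j * pmf \<mu> j = 0"
        using x(2)[OF that(1)] s by (subst sum_nonneg_eq_0_iff[symmetric]) auto
      then have "real k * pmf \<mu> k = 0" using that(2) by blast
      then show ?thesis using that(3) by simp
    qed
    have *: "pmf \<mu> k * ln (tilt \<kappa> x t k)
        = t * (real k * pmf \<mu> k) + (if k \<le> \<kappa> then real k * pmf \<mu> k * ln x else 0)" for k
    proof (cases "x = 0")
      case True
      then show ?thesis using zero[of k] by (cases "k = 0") (auto simp: tilt_def)
    next
      case False
      then show ?thesis using x(1) by (simp add: tilt_def ln_mult ln_realpow algebra_simps)
    qed
    have "(t * a + (\<Sum>k\<le>\<kappa>. real k * pmf \<mu> k * ln x)) - ln (mass \<kappa> ?l x t)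
        \<le> (\<Sum>k. pmf \<mu> k * ln (pmf \<mu> k / pois ?l k))"
    proof (rule gibbs_inequality[where v = "tilt \<kappa> x t" and q = "pois ?l" and \<mu> = "pmf \<mu>"])
      show "pmf \<mu> sums 1"
        using sums_infsetsum_nat[of "pmf \<mu>" UNIV] by (simp add: pmf_abs_summable infsetsum_pmf_eq_1)
      show "tilt \<kappa> x t k = 0 \<Longrightarrow> pmf \<mu> k = 0" for k
        using zero[of k] by (auto simp: tilt_def split: if_splits)
      show "(\<lambda>k. pmf \<mu> k * ln (tilt \<kappa> x t k)) sums (t * a + (\<Sum>k\<le>\<kappa>. real k * pmf \<mu> k * ln x))"
        unfolding * by (intro sums_add sums_mult a truncated_sums)
    qed (use True assms(1) x tilt_nonneg mass_pos tilted_pois_sums pois_pos in auto)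
    then show ?thesis
      using True assms(1)
      by (simp add: rel_entropy_def pmf_poisson_pois sum_distrib_right del: pmf_poisson)
  next
    case False
    then show ?thesis using assms(1) by (simp add: rel_entropy_def pmf_poisson_pois del: pmf_poisson)
  qed
qed

text \<open>
  The tilted law itself attains the lower bound with \<open>t = 0\<close>.
\<close>

lemma rate_IB_tilted_le:
  assumes l: "0 < b * p" and x: "0 \<le> x"
  shows "\<exists>r. rate_IB \<kappa> b p (attempts \<kappa> (b * p) x) (successes \<kappa> (b * p) x) r
    \<le> ereal (successes \<kappa> (b * p) x * ln x - ln (mass \<kappa> (b * p) x 0))"
proof -
  let ?l = "b * p"
  let ?Z = "mass \<kappa> ?l x 0"
  let ?f = "\<lambda>k. pois ?l k * tilt \<kappa> x 0 k / ?Z"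
  have Z: "0 < ?Z" using mass_pos[OF l x] .
  have f0: "0 \<le> ?f k" for k
    using pois_pos[OF l, of k] tilt_nonneg[OF x, of \<kappa> 0 k] Z by simp
  have f1: "?f sums 1"
    using sums_divide[OF tilted_pois_sums[of ?l \<kappa> x 0], where c = ?Z] Z by simp
  define \<mu> where "\<mu> = embed_pmf ?f"
  have \<mu>: "pmf \<mu> k = ?f k" for k
    unfolding \<mu>_def
  proof (rule pmf_embed_pmf[OF f0])
    show "(\<integral>\<^sup>+k. ennreal (?f k) \<partial>count_space UNIV) = 1"
      using suminf_ennreal_eq[OF f0 f1] by (simp add: nn_integral_count_space_nat)
  qed
  have mean_term: "real k * pmf \<mu> k
      = (real k * pois ?l k + (if k \<le> \<kappa> then real k * pois ?l k * (x ^ k - 1) else 0)) / ?Z" for k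
    by (simp add: \<mu> tilt_def algebra_simps diff_divide_distrib)
  have mean: "(\<lambda>k. real k * pmf \<mu> k) sums attempts \<kappa> ?l x"
    unfolding attempts_def mean_term
    by (intro sums_divide sums_add pois_mean_sums truncated_sums)
  have succ: "(\<Sum>k\<le>\<kappa>. real k * pmf \<mu> k) = successes \<kappa> ?l x"
    unfolding \<mu> successes_def sum_divide_distrib by (intro sum.cong) (auto simp: tilt_def)
  have term_eq: "pmf \<mu> k * ln (pmf \<mu> k / pois ?l k)
      = (if k \<le> \<kappa> then real k * pmf \<mu> k * ln x else 0) - pmf \<mu> k * ln ?Z" for k
  proof (cases "tilt \<kappa> x 0 k = 0")
    case True
    then show ?thesis unfolding \<mu> by simp
  next
    case False
    have "pmf \<mu> k / pois ?l k = tilt \<kappa> x 0 k / ?Z"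
      unfolding \<mu> using pois_pos[OF l, of k] by simp
    moreover have "ln (tilt \<kappa> x 0 k / ?Z) = ln (tilt \<kappa> x 0 k) - ln ?Z"
      using False Z tilt_nonneg[OF x, of \<kappa> 0 k] by (simp add: ln_div)
    moreover have "ln (tilt \<kappa> x 0 k) = (if k \<le> \<kappa> then real k * ln x else 0)"
      using False x by (cases "x = 0"; cases "k = 0") (auto simp: tilt_def ln_realpow)
    ultimately have ln_density:
      "ln (pmf \<mu> k / pois ?l k) = (if k \<le> \<kappa> then real k * ln x else 0) - ln ?Z"
      by simp
    show ?thesis unfolding ln_density by (simp add: algebra_simps)
  qed
  have "(\<lambda>k. pmf \<mu> k * ln (pmf \<mu> k / pois ?l k))
      sums ((\<Sum>k\<le>\<kappa>. real k * pmf \<mu> k * ln x) - 1 * ln ?Z)"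
    unfolding term_eq
    by (intro sums_diff truncated_sums sums_mult2) (use f1 in \<open>simp add: \<mu>\<close>)
  then have "(\<lambda>k. pmf \<mu> k * ln (pmf \<mu> k / pois ?l k)) sums (successes \<kappa> ?l x * ln x - ln ?Z)"
    by (simp add: succ flip: sum_distrib_right)
  then have "rel_entropy \<mu> (poisson_pmf ?l) = ereal (successes \<kappa> ?l x * ln x - ln ?Z)"
    using l by (simp add: rel_entropy_def pmf_poisson_pois sums_iff del: pmf_poisson)
  then have "rate_IB \<kappa> b p (attempts \<kappa> ?l x) (successes \<kappa> ?l x) (\<Sum>k\<le>\<kappa>. pmf \<mu> k)
      \<le> ereal (successes \<kappa> ?l x * ln x - ln ?Z)"
    unfolding rate_IB_def using mean succ by (intro Inf_lower) force
  then show ?thesis ..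
qed

text \<open>
  That no other \<open>a\<close> is a minimiser needs more than uniqueness of the optimal law, because a priori
  the infimum over the laws with another mean \<open>a\<close> might be the same without being attained. If \<open>a\<close> is a minimiser, then the lower bounds
  for all \<open>t\<close> lie below the one for the optimal law; so \<open>t a - ln (mass t)\<close> is maximal at \<open>t = 0\<close>, and its
  derivative \<open>a - attempts x\<close> vanishes there. Finite exponential moments of the Poisson law
  are what makes this work.
\<close>

theorem is_attempt_rate_iff:
  assumes l: "0 < b * p" and x: "0 \<le> x"
  shows "is_attempt_rate \<kappa> b p (successes \<kappa> (b * p) x) a \<longleftrightarrow> a = attempts \<kappa> (b * p) x"
proof -
  let ?l = "b * p"
  let ?s = "successes \<kappa> ?l x"
  let ?J = "\<lambda>a. INF r. rate_IB \<kappa> b p a ?s r"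
  let ?Z = "mass \<kappa> ?l x"
  have "?s = 0" if "x = 0" using that by (auto simp: successes_def power_0_left intro!: sum.neutral)
  then have lower: "ereal (t * a + ?s * ln x - ln (?Z t)) \<le> ?J a" for t a
    by (intro INF_greatest rate_IB_ge l x)
  have upper: "?J (attempts \<kappa> ?l x) \<le> ereal (?s * ln x - ln (?Z 0))"
    using rate_IB_tilted_le[OF l x] by (meson INF_lower UNIV_I order_trans)
  have le: "?J (attempts \<kappa> ?l x) \<le> ?J a" for a
    using lower[of 0 a] upper by (auto intro: order_trans)
  show ?thesis
  proof
    assume "a = attempts \<kappa> ?l x"
    then show "is_attempt_rate \<kappa> b p ?s a"
      using le by (auto simp: is_attempt_rate_def is_arg_min_def not_less)
  next
    assume "is_attempt_rate \<kappa> b p ?s a"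
    then have "?J a \<le> ?J (attempts \<kappa> ?l x)"
      by (auto simp: is_attempt_rate_def is_arg_min_def not_less)
    then have le_t: "ereal (t * a + ?s * ln x - ln (?Z t)) \<le> ereal (?s * ln x - ln (?Z 0))" for t
      using lower[of t a] upper by (meson order_trans)
    have max: "t * a - ln (?Z t) \<le> 0 * a - ln (?Z 0)" for t
      using le_t[of t] by simp
    have "((\<lambda>t. t * a - ln (?Z t)) has_real_derivative a - attempts \<kappa> ?l x) (at 0)"
      using mass_pos[OF l x, of \<kappa> 0]
      by (auto intro!: derivative_eq_intros DERIV_mass simp: attempts_def)
    from DERIV_local_max[OF this zero_less_one] max have "a - attempts \<kappa> ?l x = 0" by blast
    then show "a = attempts \<kappa> ?l x" by simp
  qed
qed

section \<open>The success rate\<close>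

text \<open>
  A sum \<open>\<Sum>k. w(k) (k - c) x^k\<close> with \<open>w \<ge> 0\<close> has one sign change in its coefficients. Replacing all powers
  \<open>x^k\<close> by the one power \<open>x powr c\<close> located at the sign change moves every term in the same direction, and
  so compares the sum with \<open>x powr c\<close> times its value at \<open>x = 1\<close>.
\<close>

lemma power_minus_powr_sign:
  fixes x c :: real
  assumes "0 < x"
  shows "1 \<le> x \<Longrightarrow> 0 \<le> (real k - c) * (x ^ k - x powr c)"
    and "x \<le> 1 \<Longrightarrow> (real k - c) * (x ^ k - x powr c) \<le> 0"
    and "1 < x \<Longrightarrow> real k \<noteq> c \<Longrightarrow> 0 < (real k - c) * (x ^ k - x powr c)"
    and "x < 1 \<Longrightarrow> real k \<noteq> c \<Longrightarrow> (real k - c) * (x ^ k - x powr c) < 0"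
proof -
  have e: "x ^ k = x powr real k" using assms by (simp add: powr_realpow)
  show "1 \<le> x \<Longrightarrow> 0 \<le> (real k - c) * (x ^ k - x powr c)"
    unfolding e by (cases "c \<le> real k") (auto simp: zero_le_mult_iff intro: powr_mono)
  show "x \<le> 1 \<Longrightarrow> (real k - c) * (x ^ k - x powr c) \<le> 0"
    unfolding e using assms by (cases "c \<le> real k") (auto simp: mult_le_0_iff intro: powr_mono')
  show "1 < x \<Longrightarrow> real k \<noteq> c \<Longrightarrow> 0 < (real k - c) * (x ^ k - x powr c)"
    unfolding e by (cases "c < real k") (auto simp: zero_less_mult_iff)
  show "x < 1 \<Longrightarrow> real k \<noteq> c \<Longrightarrow> (real k - c) * (x ^ k - x powr c) < 0"
    unfolding e using assms by (cases "c < real k") (auto simp: mult_less_0_iff powr_less_mono')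
qed

lemma successes_1_pos: "1 \<le> \<kappa> \<Longrightarrow> 0 < l \<Longrightarrow> 0 < successes \<kappa> l 1"
  unfolding at_1 by (rule sum_pos2[of _ 1]) (auto simp: pois_pos less_imp_le)

text \<open>
  This rests on the single sign change of the coefficients \<open>k - c\<close>, where \<open>c\<close> is the number of
  successes at \<open>x = 1\<close>.
\<close>

lemma successes_strict_at_1:
  assumes \<kappa>: "1 \<le> \<kappa>" and l: "0 < l" and x: "0 < x"
  shows "x < 1 \<Longrightarrow> successes \<kappa> l x < successes \<kappa> l 1"
    and "1 < x \<Longrightarrow> successes \<kappa> l 1 < successes \<kappa> l x"
proof -
  define c where "c = successes \<kappa> l 1"
  let ?T = "1 - (\<Sum>k\<le>\<kappa>. pois l k)"
  let ?D = "\<Sum>k\<le>\<kappa>. pois l k * ((real k - c) * (x ^ k - x powr c))"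
  have c: "0 < c" using successes_1_pos[OF \<kappa> l] by (simp add: c_def)
  have T: "0 < ?T" using sum_pois_less_1[OF l] by simp
  have Z: "0 < mass \<kappa> l x 0" using mass_pos[OF l] x by simp
  have "(\<Sum>k\<le>\<kappa>. pois l k * (real k - c)) = (\<Sum>k\<le>\<kappa>. real k * pois l k) - c * (\<Sum>k\<le>\<kappa>. pois l k)"
    by (simp add: algebra_simps sum_subtractf sum_distrib_left)
  then have centred: "(\<Sum>k\<le>\<kappa>. pois l k * (real k - c)) = c * ?T"
    by (simp add: right_diff_distrib flip: at_1(2) c_def)
  have "(\<Sum>k\<le>\<kappa>. real k * pois l k * x ^ k) - c * mass \<kappa> l x 0
      = (\<Sum>k\<le>\<kappa>. pois l k * ((real k - c) * x ^ k)) - c * ?T"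
    by (simp add: mass_0 algebra_simps sum_subtractf sum.distrib sum_distrib_left)
  also have "\<dots> = ?D + x powr c * (\<Sum>k\<le>\<kappa>. pois l k * (real k - c)) - c * ?T"
    by (simp add: algebra_simps sum_subtractf sum.distrib sum_distrib_left)
  finally have key: "(\<Sum>k\<le>\<kappa>. real k * pois l k * x ^ k) - c * mass \<kappa> l x 0
      = ?D + (x powr c - 1) * (c * ?T)"
    by (simp only: centred) (simp only: algebra_simps)
  show "successes \<kappa> l x < successes \<kappa> l 1" if "x < 1"
  proof -
    have "?D \<le> 0" using that x pois_pos[OF l]
      by (intro sum_nonpos mult_nonneg_nonpos power_minus_powr_sign(2)) (auto intro: less_imp_le)
    moreover have "(x powr c - 1) * (c * ?T) < 0"
      using that x c T powr_less_mono2[of c x 1] by (intro mult_neg_pos) auto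
    ultimately have "(\<Sum>k\<le>\<kappa>. real k * pois l k * x ^ k) < c * mass \<kappa> l x 0" using key by linarith
    then show ?thesis using Z unfolding c_def[symmetric] by (simp add: successes_def divide_less_eq)
  qed
  show "successes \<kappa> l 1 < successes \<kappa> l x" if "1 < x"
  proof -
    have "0 \<le> ?D" using that x pois_pos[OF l]
      by (intro sum_nonneg mult_nonneg_nonneg power_minus_powr_sign(1)) (auto intro: less_imp_le)
    moreover have "0 < (x powr c - 1) * (c * ?T)"
      using that x c T by (intro mult_pos_pos) auto
    ultimately have "c * mass \<kappa> l x 0 < (\<Sum>k\<le>\<kappa>. real k * pois l k * x ^ k)" using key by linarith
    then show ?thesis using Z unfolding c_def[symmetric] by (simp add: successes_def less_divide_eq)
  qed
qed

lemma continuous_on_successes: "0 < l \<Longrightarrow> 0 \<le> u \<Longrightarrow> continuous_on {u..v} (successes \<kappa> l)"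
  unfolding successes_def
proof (intro continuous_on_divide continuous_intros ballI)
  show "continuous_on {u..v} (\<lambda>x. mass \<kappa> l x 0)"
    unfolding mass_0 by (intro continuous_intros)
  show "mass \<kappa> l x 0 \<noteq> 0" if "0 < l" "0 \<le> u" "x \<in> {u..v}" for x
    using mass_pos[OF that(1), of x \<kappa> 0] that by auto
qed

text \<open>
  Values \<open>s\<close> near the typical one come from tilts near \<open>1\<close>, on the matching side of \<open>1\<close>.
\<close>

lemma successes_local_inverse:
  assumes \<kappa>: "1 \<le> \<kappa>" and l: "0 < l" and d: "0 < d"
  shows "\<forall>\<^sub>F s in nhds (successes \<kappa> l 1). \<exists>x. 0 < x \<and> \<bar>x - 1\<bar> < d \<and> s = successes \<kappa> l x \<and>
    (s < successes \<kappa> l 1 \<longrightarrow> x < 1) \<and> (successes \<kappa> l 1 < s \<longrightarrow> 1 < x)"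
proof -
  let ?S = "successes \<kappa> l"
  define e where "e = min d 1 / 2"
  have e: "0 < e" "e < d" "e < 1" using d by (auto simp: e_def)
  have "?S 1 \<in> {?S (1 - e)<..<?S (1 + e)}"
    using successes_strict_at_1[OF \<kappa> l] e by simp
  then have "\<forall>\<^sub>F s in nhds (?S 1). s \<in> {?S (1 - e)<..<?S (1 + e)}"
    by (intro eventually_nhds_in_open) auto
  then show ?thesis
  proof eventually_elim
    case (elim s)
    then obtain x where x: "1 - e \<le> x" "x \<le> 1 + e" "?S x = s"
      using IVT'[of ?S "1 - e" s "1 + e"] continuous_on_successes[OF l, of "1 - e" "1 + e" \<kappa>] e by auto
    then show ?case
      using e successes_strict_at_1[OF \<kappa> l, of x]
      by (intro exI[of _ x]) (cases x "1::real" rule: linorder_cases; auto)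
  qed
qed

text \<open>
  The number of successes is \<open>0\<close> at \<open>x = 0\<close>, and it tends to \<open>\<kappa>\<close> for \<open>x \<rightarrow> \<infinity>\<close> because the term \<open>k = \<kappa>\<close>
  dominates; the intermediate value theorem gives the rest.
\<close>

lemma successes_surj:
  assumes l: "0 < l" and s: "0 \<le> s" "s < real \<kappa>"
  shows "\<exists>x\<ge>0. successes \<kappa> l x = s"
proof -
  have "0 < \<kappa>" using s by auto
  then obtain n where n: "\<kappa> = Suc n" using gr0_implies_Suc by blast
  define q where "q = (real \<kappa> - s) * pois l \<kappa>"
  \<comment> \<open>Chosen such that \<open>q X - s \<ge> s\<close>: the term \<open>k = \<kappa>\<close> contributes \<open>q X^\<kappa>\<close>, all others together at least
    \<open>- s X^(\<kappa>-1)\<close>, and a surplus of \<open>s\<close> is needed to outweigh the untilted tail.\<close>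
  define X where "X = 1 + 2 * s / q"
  have q: "0 < q" using s pois_pos[OF l] by (simp add: q_def)
  have X: "1 \<le> X" using s q by (simp add: X_def)
  have sum_n: "(\<Sum>k\<le>n. pois l k) \<le> 1" "(\<Sum>k\<le>\<kappa>. pois l k) \<ge> 0"
    using sum_pois_less_1[OF l, of n] pois_pos[OF l] by (auto intro: less_imp_le sum_nonneg)
  have "(\<Sum>k\<le>\<kappa>. pois l k * ((real k - s) * X ^ k))
      = q * X ^ \<kappa> + (\<Sum>k\<le>n. pois l k * ((real k - s) * X ^ k))"
    by (simp add: n q_def)
  moreover have "(\<Sum>k\<le>n. pois l k * (- s * X ^ n)) \<le> (\<Sum>k\<le>n. pois l k * ((real k - s) * X ^ k))"
  proof (intro sum_mono mult_left_mono)
    fix k assume "k \<in> {..n}"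
    then have "s * X ^ k \<le> s * X ^ n" using X s by (intro mult_left_mono power_increasing) auto
    moreover have "0 \<le> real k * X ^ k" using X by simp
    ultimately show "- s * X ^ n \<le> (real k - s) * X ^ k" by (simp add: algebra_simps)
  qed (use pois_pos[OF l] in \<open>auto intro: less_imp_le\<close>)
  moreover have "- (s * X ^ n) \<le> (\<Sum>k\<le>n. pois l k * (- s * X ^ n))"
    using mult_right_mono[OF sum_n(1), of "s * X ^ n"] X s
    by (simp add: sum_distrib_right[symmetric] sum_negf)
  ultimately have "X ^ n * (q * X - s) \<le> (\<Sum>k\<le>\<kappa>. pois l k * ((real k - s) * X ^ k))"
    by (simp add: n algebra_simps)
  moreover have "s \<le> X ^ n * (q * X - s)"
  proof -
    have "s \<le> q * X - s" using q by (simp add: X_def field_simps)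
    also have "\<dots> \<le> X ^ n * (q * X - s)"
      using mult_right_mono[OF one_le_power[OF X, of n], of "q * X - s"] calculation s by simp
    finally show ?thesis .
  qed
  moreover have "s * (1 - (\<Sum>k\<le>\<kappa>. pois l k)) \<le> s"
    using mult_left_mono[of "1 - (\<Sum>k\<le>\<kappa>. pois l k)" 1 s] sum_n(2) s by simp
  moreover have "(\<Sum>k\<le>\<kappa>. real k * pois l k * X ^ k) - s * mass \<kappa> l X 0
      = (\<Sum>k\<le>\<kappa>. pois l k * ((real k - s) * X ^ k)) - s * (1 - (\<Sum>k\<le>\<kappa>. pois l k))"
    by (simp add: mass_0 algebra_simps sum_subtractf sum.distrib sum_distrib_left)
  ultimately have "s * mass \<kappa> l X 0 \<le> (\<Sum>k\<le>\<kappa>. real k * pois l k * X ^ k)" by linarith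
  then have "s \<le> successes \<kappa> l X"
    using mass_pos[OF l, of X \<kappa> 0] X by (simp add: successes_def le_divide_eq)
  moreover have "successes \<kappa> l 0 = 0"
    by (auto simp: successes_def power_0_left intro!: sum.neutral)
  ultimately show ?thesis
    using IVT'[of "successes \<kappa> l" 0 s X] continuous_on_successes[OF l, of 0 X \<kappa>] s X by auto
qed

section \<open>The covariance of attempts and successes\<close>

text \<open>
  The covariance under the Poisson law of the number of attempts \<open>k\<close> and the number of successes, which
  is \<open>k\<close> if \<open>k \<le> \<kappa>\<close> and \<open>0\<close> otherwise.
\<close>

definition attempt_success_cov :: "nat \<Rightarrow> real \<Rightarrow> real" where
  "attempt_success_cov \<kappa> l = (\<Sum>k\<le>\<kappa>. real k * (real k - l) * pois l k)"

text \<open>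
  Since \<open>k q(k) = l q(k-1)\<close>, each term equals \<open>l (q(k-1) + (k-1) q(k-1) - k q(k))\<close>, and the last two
  parts telescope. The last factor is the difference of the two sides of the
  equation that characterises \<open>a_* = b p_*\<close>, because \<open>\<kappa> / fact \<kappa> = 1 / fact (\<kappa> - 1)\<close>.
\<close>

lemma attempt_success_cov_eq:
  "attempt_success_cov \<kappa> l = exp (- l) * l * ((\<Sum>i<\<kappa>. l ^ i / fact i) - real \<kappa> * l ^ \<kappa> / fact \<kappa>)"
proof (induction \<kappa>)
  case 0
  then show ?case by (simp add: attempt_success_cov_def)
next
  case (Suc n)
  have "attempt_success_cov (Suc n) l = attempt_success_cov n l + real (Suc n) * (real (Suc n) - l) * pois l (Suc n)"
    by (simp add: attempt_success_cov_def)
  also have "real (Suc n) * (real (Suc n) - l) * pois l (Suc n)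
      = (real (Suc n) - l) * (l * pois l n)"
    using pois_Suc[of n l] by (metis mult.assoc mult.commute)
  also have "attempt_success_cov n l + \<dots> = exp (- l) * l *
      ((\<Sum>i<n. l ^ i / fact i) - real n * l ^ n / fact n + (real (Suc n) - l) * (l ^ n / fact n))"
    unfolding Suc by (simp add: pois_def algebra_simps)
  also have "(\<Sum>i<n. l ^ i / fact i) - real n * l ^ n / fact n + (real (Suc n) - l) * (l ^ n / fact n)
      = (\<Sum>i<Suc n. l ^ i / fact i) - l * (l ^ n / fact n)"
    by (simp add: field_simps)
  also have "l * (l ^ n / fact n) = real (Suc n) * l ^ Suc n / fact (Suc n)"
    by (simp add: field_simps del: of_nat_Suc)
  finally show ?case .
qed

text \<open>
  Divided by \<open>l^\<kappa>\<close>, the last factor of the closed form is strictly decreasing in \<open>l\<close>, so it has at most one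
  zero. It is \<open>1\<close> at \<open>l = 0\<close>. At \<open>l = \<kappa>\<close> all terms \<open>k (k - l) q(k)\<close> of the covariance are nonpositive, and
  for \<open>\<kappa> \<ge> 2\<close> the term \<open>k = 1\<close> is negative; hence the zero lies in \<open>(0, \<kappa>]\<close>, and not at \<open>\<kappa>\<close> if \<open>\<kappa> \<ge> 2\<close>.
\<close>

lemma attempt_success_cov_sign_change:
  assumes \<kappa>: "1 \<le> \<kappa>"
  obtains c where "0 < c" "2 \<le> \<kappa> \<Longrightarrow> c < real \<kappa>" "attempt_success_cov \<kappa> c = 0"
    "\<And>l. 0 < l \<Longrightarrow> l < c \<Longrightarrow> 0 < attempt_success_cov \<kappa> l" "\<And>l. c < l \<Longrightarrow> attempt_success_cov \<kappa> l < 0"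
proof -
  define f where "f = (\<lambda>l::real. (\<Sum>i<\<kappa>. l ^ i / fact i) - real \<kappa> * l ^ \<kappa> / fact \<kappa>)"
  have cov_f: "attempt_success_cov \<kappa> l = (exp (- l) * l) * f l" for l by (simp add: attempt_success_cov_eq f_def)
  have nonpos: "real k * (real k - real \<kappa>) * pois (real \<kappa>) k \<le> 0" if "k \<le> \<kappa>" for k
    using that \<kappa> pois_pos[of "real \<kappa>" k]
    by (intro mult_nonpos_nonneg mult_nonneg_nonpos) (auto intro: less_imp_le)
  then have "attempt_success_cov \<kappa> (real \<kappa>) \<le> 0" unfolding attempt_success_cov_def by (intro sum_nonpos) auto
  then have "f (real \<kappa>) \<le> 0" using \<kappa> by (simp add: cov_f mult_le_0_iff)
  moreover have f0: "f 0 = 1"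
    using \<kappa> by (simp add: f_def power_0_left if_distrib[of "\<lambda>u. u / _"] cong: if_cong)
  moreover have "continuous_on {0..real \<kappa>} f" unfolding f_def by (intro continuous_intros) auto
  ultimately obtain c where c: "0 \<le> c" "c \<le> real \<kappa>" "f c = 0"
    using IVT2'[of f "real \<kappa>" 0 0] by auto
  then have c0: "0 < c" using f0 by (cases "c = 0") auto
  have scaled: "f l * m ^ \<kappa> < f m * l ^ \<kappa>" if "0 < m" "m < l" for l m
  proof -
    have "l ^ i * m ^ \<kappa> < m ^ i * l ^ \<kappa>" if "i < \<kappa>" for i
    proof -
      have "m ^ (\<kappa> - i) < l ^ (\<kappa> - i)"
        using \<open>0 < m\<close> \<open>m < l\<close> \<open>i < \<kappa>\<close> by (intro power_strict_mono) auto
      then have "(l ^ i * m ^ i) * m ^ (\<kappa> - i) < (l ^ i * m ^ i) * l ^ (\<kappa> - i)"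
        using \<open>0 < m\<close> \<open>m < l\<close> by (intro mult_strict_left_mono) auto
      moreover have "m ^ \<kappa> = m ^ i * m ^ (\<kappa> - i)" "l ^ \<kappa> = l ^ i * l ^ (\<kappa> - i)"
        using \<open>i < \<kappa>\<close> by (simp_all flip: power_add)
      ultimately show ?thesis by (simp only: mult_ac)
    qed
    then have "(\<Sum>i<\<kappa>. l ^ i * m ^ \<kappa> / fact i) < (\<Sum>i<\<kappa>. m ^ i * l ^ \<kappa> / fact i)"
      using \<kappa> by (intro sum_strict_mono divide_strict_right_mono) (auto simp: lessThan_empty_iff)
    then show ?thesis by (simp add: f_def algebra_simps sum_distrib_left)
  qed
  show thesis
  proof (rule that[OF c0])
    show "attempt_success_cov \<kappa> c = 0" using c by (simp add: cov_f)
    show "0 < attempt_success_cov \<kappa> l" if "0 < l" "l < c" for l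
      using scaled[OF that] c that by (simp add: cov_f zero_less_mult_iff)
    show "attempt_success_cov \<kappa> l < 0" if "c < l" for l
      using scaled[OF c0 that] c c0 that by (simp add: cov_f mult_less_0_iff)
    show "c < real \<kappa>" if "2 \<le> \<kappa>"
    proof -
      have "attempt_success_cov \<kappa> (real \<kappa>) = (\<Sum>k\<in>{..\<kappa>} - {1}. real k * (real k - real \<kappa>) * pois (real \<kappa>) k)
          + (1 - real \<kappa>) * pois (real \<kappa>) 1"
        unfolding attempt_success_cov_def using that by (subst sum.remove[of _ 1]) auto
      moreover have "(\<Sum>k\<in>{..\<kappa>} - {1}. real k * (real k - real \<kappa>) * pois (real \<kappa>) k) \<le> 0"
        using nonpos by (intro sum_nonpos) auto
      moreover have "(1 - real \<kappa>) * pois (real \<kappa>) 1 < 0"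
        using that pois_pos[of "real \<kappa>" 1] by (intro mult_neg_pos) auto
      ultimately have "attempt_success_cov \<kappa> (real \<kappa>) \<noteq> 0" by linarith
      then have "c \<noteq> real \<kappa>" using c by (auto simp: cov_f)
      then show ?thesis using c by simp
    qed
  qed
qed

text \<open>
  The link between the maximisation of throughput and the response of the attempts: differentiating the
  Poisson weight \<open>q(k)\<close> in \<open>l\<close> multiplies it by \<open>(k - l) / l\<close>.
\<close>

lemma DERIV_typical_successes:
  assumes "l \<noteq> 0"
  shows "((\<lambda>l. successes \<kappa> l 1) has_real_derivative attempt_success_cov \<kappa> l / l) (at l)"
proof -
  have "((\<lambda>l. real k * pois l k) has_real_derivative real k * (real k - l) * pois l k / l) (at l)" for k
  proof -
    have "((\<lambda>l. real k * pois l k) has_real_derivative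
        real k * (real k * l ^ (k - 1) / fact k * exp (- l) - l ^ k / fact k * exp (- l))) (at l)"
      unfolding pois_def by (auto intro!: derivative_eq_intros simp: field_simps)
    also have "real k * (real k * l ^ (k - 1) / fact k * exp (- l) - l ^ k / fact k * exp (- l))
        = real k * (real k - l) * pois l k / l"
      using assms by (cases k) (simp_all add: pois_def field_simps del: fact_Suc of_nat_Suc)
    finally show ?thesis .
  qed
  then show ?thesis
    unfolding at_1 attempt_success_cov_def sum_divide_distrib by (intro DERIV_sum)
qed

lemma is_arg_max_s_typ:
  assumes b: "0 < b" and c: "0 < c"
    and pos: "\<And>l. 0 < l \<Longrightarrow> l < c \<Longrightarrow> 0 < attempt_success_cov \<kappa> l" and neg: "\<And>l. c < l \<Longrightarrow> attempt_success_cov \<kappa> l < 0"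
  shows "is_arg_max (s_typ \<kappa> b) (\<lambda>p. 0 < p) p \<longleftrightarrow> p = c / b"
proof -
  have less: "s_typ \<kappa> b p < s_typ \<kappa> b (c / b)" if p: "0 < p" "p \<noteq> c / b" for p
  proof (cases "b * p < c")
    case True
    have "successes \<kappa> (b * p) 1 < successes \<kappa> c 1"
    proof (rule DERIV_pos_imp_increasing_open[OF True])
      fix l assume "b * p < l" "l < c"
      moreover have "0 < b * p" using b p by simp
      ultimately show "\<exists>y. ((\<lambda>l. successes \<kappa> l 1) has_real_derivative y) (at l) \<and> 0 < y"
        using DERIV_typical_successes[of l \<kappa>] pos[of l] by (intro exI[of _ "attempt_success_cov \<kappa> l / l"]) auto
    qed (auto simp: at_1 pois_def intro!: continuous_intros)
    then show ?thesis using b by (simp add: s_typ_successes)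
  next
    case False
    then have gt: "c < b * p" using p b by (auto simp: field_simps)
    have "successes \<kappa> (b * p) 1 < successes \<kappa> c 1"
    proof (rule DERIV_neg_imp_decreasing_open[OF gt])
      fix l assume "c < l" "l < b * p"
      then show "\<exists>y. ((\<lambda>l. successes \<kappa> l 1) has_real_derivative y) (at l) \<and> y < 0"
        using DERIV_typical_successes[of l \<kappa>] neg[of l] c
        by (intro exI[of _ "attempt_success_cov \<kappa> l / l"]) (auto simp: divide_neg_pos)
    qed (auto simp: at_1 pois_def intro!: continuous_intros)
    then show ?thesis using b by (simp add: s_typ_successes)
  qed
  have "0 < c / b" using b c by simp
  then show ?thesis
    using less by (auto simp: is_arg_max_def) (metis less_asym)+
qed

section \<open>Comparing attempt rates\<close>

text \<open>
  The numerator of \<open>attempts x - l\<close> over the positive normalising constant. The tails cancel, which leaves a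
  polynomial in \<open>x\<close>.
\<close>

definition excess :: "nat \<Rightarrow> real \<Rightarrow> real \<Rightarrow> real" where
  "excess \<kappa> l x = (\<Sum>k\<le>\<kappa>. (real k - l) * pois l k * (x ^ k - 1))"

lemma excess_sign:
  assumes "0 < l" "0 \<le> x"
  shows "l < attempts \<kappa> l x \<longleftrightarrow> 0 < excess \<kappa> l x"
    and "attempts \<kappa> l x < l \<longleftrightarrow> excess \<kappa> l x < 0"
proof -
  have "l + (\<Sum>k\<le>\<kappa>. real k * pois l k * (x ^ k - 1)) - l * mass \<kappa> l x 0 = excess \<kappa> l x"
    by (simp add: excess_def mass_0 algebra_simps sum_subtractf sum.distrib sum_distrib_left)
  then show "l < attempts \<kappa> l x \<longleftrightarrow> 0 < excess \<kappa> l x" "attempts \<kappa> l x < l \<longleftrightarrow> excess \<kappa> l x < 0"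
    using mass_pos[OF assms, of \<kappa> 0] by (auto simp: attempts_def less_divide_eq divide_less_eq)
qed

lemma DERIV_excess:
  "(excess \<kappa> l has_real_derivative (\<Sum>k\<le>\<kappa>. (real k - l) * pois l k * (real k * x ^ (k - 1)))) (at x)"
  unfolding excess_def by (auto intro!: derivative_eq_intros sum.cong)

lemma excess_1: "excess \<kappa> l 1 = 0"
  by (simp add: excess_def)

lemma DERIV_excess_1: "(excess \<kappa> l has_real_derivative attempt_success_cov \<kappa> l) (at 1)"
  using DERIV_excess[of \<kappa> l 1] by (simp add: attempt_success_cov_def mult_ac)

text \<open>
  When the covariance vanishes, subtracting \<open>y powr l\<close> times it from \<open>y excess'(y)\<close> changes nothing, and
  turns every term into one with the sign of \<open>y - 1\<close>. The term \<open>k = \<kappa>\<close> is split off because \<open>l < \<kappa>\<close>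
  makes its sign strict.
\<close>

lemma excess_pos_critical:
  assumes l: "0 < l" "l < real \<kappa>" and crit: "attempt_success_cov \<kappa> l = 0" and x: "0 \<le> x" "x \<noteq> 1"
  shows "0 < excess \<kappa> l x"
proof -
  let ?D = "\<lambda>y. \<Sum>k\<le>\<kappa>. (real k - l) * pois l k * (real k * y ^ (k - 1))"
  have eq: "y * ?D y = (\<Sum>k\<le>\<kappa>. real k * pois l k * ((real k - l) * (y ^ k - y powr l)))" for y
  proof -
    have "y * ?D y = (\<Sum>k\<le>\<kappa>. real k * (real k - l) * pois l k * y ^ k)"
      unfolding sum_distrib_left
    proof (intro sum.cong refl)
      fix k
      show "y * ((real k - l) * pois l k * (real k * y ^ (k - 1)))
          = real k * (real k - l) * pois l k * y ^ k"
        by (cases k) auto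
    qed
    also have "\<dots> = (\<Sum>k\<le>\<kappa>. real k * (real k - l) * pois l k * y ^ k) - y powr l * attempt_success_cov \<kappa> l"
      by (simp add: crit)
    also have "\<dots> = (\<Sum>k\<le>\<kappa>. real k * pois l k * ((real k - l) * (y ^ k - y powr l)))"
      by (simp add: attempt_success_cov_def algebra_simps sum_subtractf sum.distrib sum_distrib_left)
    finally show ?thesis .
  qed
  have \<kappa>: "0 < real \<kappa>" using l by linarith
  have split: "y * ?D y = real \<kappa> * pois l \<kappa> * ((real \<kappa> - l) * (y ^ \<kappa> - y powr l))
      + (\<Sum>k<\<kappa>. real k * pois l k * ((real k - l) * (y ^ k - y powr l)))" for y
    unfolding eq by (subst lessThan_Suc_atMost[symmetric]) simp
  have nonneg: "0 \<le> real k * pois l k" for k using pois_pos[OF l(1), of k] by simp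
  have above: "0 < ?D y" if "1 < y" for y
  proof -
    have "0 < real \<kappa> * pois l \<kappa> * ((real \<kappa> - l) * (y ^ \<kappa> - y powr l))"
      using that l \<kappa> pois_pos[OF l(1)] by (intro mult_pos_pos[OF _ power_minus_powr_sign(3)]) auto
    moreover have "0 \<le> (\<Sum>k<\<kappa>. real k * pois l k * ((real k - l) * (y ^ k - y powr l)))"
      using that nonneg by (intro sum_nonneg mult_nonneg_nonneg[OF _ power_minus_powr_sign(1)]) auto
    ultimately have "0 < y * ?D y" unfolding split by linarith
    then show ?thesis using that by (simp add: zero_less_mult_iff)
  qed
  have below: "?D y < 0" if "0 < y" "y < 1" for y
  proof -
    have "real \<kappa> * pois l \<kappa> * ((real \<kappa> - l) * (y ^ \<kappa> - y powr l)) < 0"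
      using that l \<kappa> pois_pos[OF l(1)] by (intro mult_pos_neg[OF _ power_minus_powr_sign(4)]) auto
    moreover have "(\<Sum>k<\<kappa>. real k * pois l k * ((real k - l) * (y ^ k - y powr l))) \<le> 0"
      using that nonneg by (intro sum_nonpos mult_nonneg_nonpos[OF _ power_minus_powr_sign(2)]) auto
    ultimately have "y * ?D y < 0" unfolding split by linarith
    then show ?thesis using that by (simp add: mult_less_0_iff)
  qed
  have cont: "continuous_on A (excess \<kappa> l)" for A
    unfolding excess_def by (intro continuous_intros)
  show ?thesis
  proof (cases "x < 1")
    case True
    have "excess \<kappa> l 1 < excess \<kappa> l x"
      using DERIV_excess below x
      by (intro DERIV_neg_imp_decreasing_open[OF True _ cont]) force
    then show ?thesis by (simp add: excess_1)
  next
    case False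
    then have gt: "1 < x" using x by simp
    have "excess \<kappa> l 1 < excess \<kappa> l x"
      using DERIV_excess above
      by (intro DERIV_pos_imp_increasing_open[OF gt _ cont]) force
    then show ?thesis by (simp add: excess_1)
  qed
qed

text \<open>
  Near \<open>x = 1\<close> the sign of \<open>excess\<close> is determined by its derivative at \<open>1\<close>, the covariance.
\<close>

lemma attempts_near_typical:
  assumes \<kappa>: "1 \<le> \<kappa>" and l: "0 < l"
  shows "\<forall>\<^sub>F s in nhds (successes \<kappa> l 1). \<exists>x>0. s = successes \<kappa> l x \<and>
      (0 < attempt_success_cov \<kappa> l \<longrightarrow> (s < successes \<kappa> l 1 \<longrightarrow> attempts \<kappa> l x < l) \<and>
                          (successes \<kappa> l 1 < s \<longrightarrow> l < attempts \<kappa> l x)) \<and>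
      (attempt_success_cov \<kappa> l < 0 \<longrightarrow> (s < successes \<kappa> l 1 \<longrightarrow> l < attempts \<kappa> l x) \<and>
                          (successes \<kappa> l 1 < s \<longrightarrow> attempts \<kappa> l x < l))"
proof -
  have "\<exists>d>0. \<forall>x. \<bar>x - 1\<bar> < d \<longrightarrow>
      (0 < attempt_success_cov \<kappa> l \<longrightarrow> (x < 1 \<longrightarrow> excess \<kappa> l x < 0) \<and> (1 < x \<longrightarrow> 0 < excess \<kappa> l x)) \<and>
      (attempt_success_cov \<kappa> l < 0 \<longrightarrow> (x < 1 \<longrightarrow> 0 < excess \<kappa> l x) \<and> (1 < x \<longrightarrow> excess \<kappa> l x < 0))"
  proof (cases "attempt_success_cov \<kappa> l" "0 :: real" rule: linorder_cases)
    case less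
    from DERIV_neg_dec_left[OF DERIV_excess_1 less] obtain d1 where d1: "0 < d1"
      "\<And>h. 0 < h \<Longrightarrow> h < d1 \<Longrightarrow> excess \<kappa> l 1 < excess \<kappa> l (1 - h)" by blast
    from DERIV_neg_dec_right[OF DERIV_excess_1 less] obtain d2 where d2: "0 < d2"
      "\<And>h. 0 < h \<Longrightarrow> h < d2 \<Longrightarrow> excess \<kappa> l (1 + h) < excess \<kappa> l 1" by blast
    show ?thesis
      using d1(1) d2(1) d1(2)[of "1 - x" for x] d2(2)[of "x - 1" for x] less
      by (intro exI[of _ "min d1 d2"]) (auto simp: excess_1)
  next
    case greater
    from DERIV_pos_inc_left[OF DERIV_excess_1 greater] obtain d1 where d1: "0 < d1"
      "\<And>h. 0 < h \<Longrightarrow> h < d1 \<Longrightarrow> excess \<kappa> l (1 - h) < excess \<kappa> l 1" by blast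
    from DERIV_pos_inc_right[OF DERIV_excess_1 greater] obtain d2 where d2: "0 < d2"
      "\<And>h. 0 < h \<Longrightarrow> h < d2 \<Longrightarrow> excess \<kappa> l 1 < excess \<kappa> l (1 + h)" by blast
    show ?thesis
      using d1(1) d2(1) d1(2)[of "1 - x" for x] d2(2)[of "x - 1" for x] greater
      by (intro exI[of _ "min d1 d2"]) (auto simp: excess_1)
  qed (auto intro: exI[of _ 1])
  then obtain d where d: "0 < d" "\<And>x. \<bar>x - 1\<bar> < d \<Longrightarrow>
      (0 < attempt_success_cov \<kappa> l \<longrightarrow> (x < 1 \<longrightarrow> excess \<kappa> l x < 0) \<and> (1 < x \<longrightarrow> 0 < excess \<kappa> l x)) \<and>
      (attempt_success_cov \<kappa> l < 0 \<longrightarrow> (x < 1 \<longrightarrow> 0 < excess \<kappa> l x) \<and> (1 < x \<longrightarrow> excess \<kappa> l x < 0))"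
    by blast
  from successes_local_inverse[OF \<kappa> l d(1)] show ?thesis
  proof eventually_elim
    case (elim s)
    then obtain x where x: "0 < x" "\<bar>x - 1\<bar> < d" "s = successes \<kappa> l x"
      "s < successes \<kappa> l 1 \<Longrightarrow> x < 1" "successes \<kappa> l 1 < s \<Longrightarrow> 1 < x" by blast
    then show ?case
      using d(2)[OF x(2)] excess_sign[OF l, of x \<kappa>] by (intro exI[of _ x]) auto
  qed
qed

theorem theorem1p15:
  fixes \<kappa> :: nat and b :: real and a :: "real \<Rightarrow> real \<Rightarrow> real"
  assumes "1 \<le> \<kappa>" and "0 < b"
    and "\<And>p s. 0 < p \<Longrightarrow> \<exists>x. is_attempt_rate \<kappa> b p s x \<Longrightarrow> is_attempt_rate \<kappa> b p s (a p s)"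
  shows "(\<forall>p>0. \<forall>\<^sub>F s in nhds (s_typ \<kappa> b p).
            (p < p_star \<kappa> b \<longrightarrow>
               (s < s_typ \<kappa> b p \<longrightarrow> a p s < a p (s_typ \<kappa> b p)) \<and>
               (s > s_typ \<kappa> b p \<longrightarrow> a p s > a p (s_typ \<kappa> b p))) \<and>
            (p > p_star \<kappa> b \<longrightarrow>
               (s < s_typ \<kappa> b p \<longrightarrow> a p s > a p (s_typ \<kappa> b p)) \<and>
               (s > s_typ \<kappa> b p \<longrightarrow> a p s < a p (s_typ \<kappa> b p))))
       \<and> (2 \<le> \<kappa> \<longrightarrow>
            (\<forall>s \<in> {0..p_star \<kappa> b * b} - {s_typ \<kappa> b (p_star \<kappa> b)}.
               a (p_star \<kappa> b) s > a (p_star \<kappa> b) (s_typ \<kappa> b (p_star \<kappa> b))))"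
proof -
  obtain c where c: "0 < c" "2 \<le> \<kappa> \<Longrightarrow> c < real \<kappa>" "attempt_success_cov \<kappa> c = 0"
    "\<And>l. 0 < l \<Longrightarrow> l < c \<Longrightarrow> 0 < attempt_success_cov \<kappa> l" "\<And>l. c < l \<Longrightarrow> attempt_success_cov \<kappa> l < 0"
    using attempt_success_cov_sign_change[OF assms(1)] by blast
  have p_star: "p_star \<kappa> b = c / b"
    unfolding p_star_def
    by (rule the_equality) (simp_all add: is_arg_max_s_typ[OF assms(2) c(1,4,5)])
  have a_eq: "a p (successes \<kappa> (b * p) x) = attempts \<kappa> (b * p) x" if "0 < p" "0 \<le> x" for p x
    using assms(2) assms(3)[OF that(1), of "successes \<kappa> (b * p) x"] that is_attempt_rate_iff[of b p x \<kappa>]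
    by simp
  have a_typ: "a p (s_typ \<kappa> b p) = b * p" if "0 < p" for p
    using a_eq[OF that, of 1] by (simp add: s_typ_successes at_1)
  show ?thesis
  proof (intro conjI allI impI ballI)
    fix p :: real assume p: "0 < p"
    then have l: "0 < b * p" using assms(2) by simp
    show "\<forall>\<^sub>F s in nhds (s_typ \<kappa> b p).
            (p < p_star \<kappa> b \<longrightarrow>
               (s < s_typ \<kappa> b p \<longrightarrow> a p s < a p (s_typ \<kappa> b p)) \<and>
               (s > s_typ \<kappa> b p \<longrightarrow> a p s > a p (s_typ \<kappa> b p))) \<and>
            (p > p_star \<kappa> b \<longrightarrow>
               (s < s_typ \<kappa> b p \<longrightarrow> a p s > a p (s_typ \<kappa> b p)) \<and>
               (s > s_typ \<kappa> b p \<longrightarrow> a p s < a p (s_typ \<kappa> b p)))"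
      unfolding s_typ_successes
      using attempts_near_typical[OF assms(1) l]
    proof eventually_elim
      case (elim s)
      then obtain x where x: "0 < x" "s = successes \<kappa> (b * p) x" and
        cmp: "0 < attempt_success_cov \<kappa> (b * p) \<Longrightarrow> (s < successes \<kappa> (b * p) 1 \<longrightarrow> attempts \<kappa> (b * p) x < b * p) \<and>
                  (successes \<kappa> (b * p) 1 < s \<longrightarrow> b * p < attempts \<kappa> (b * p) x)"
        "attempt_success_cov \<kappa> (b * p) < 0 \<Longrightarrow> (s < successes \<kappa> (b * p) 1 \<longrightarrow> b * p < attempts \<kappa> (b * p) x) \<and>
                  (successes \<kappa> (b * p) 1 < s \<longrightarrow> attempts \<kappa> (b * p) x < b * p)" by blast
      have "a p s = attempts \<kappa> (b * p) x" using a_eq[OF p, of x] x by simp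
      moreover have "p < p_star \<kappa> b \<Longrightarrow> b * p < c" "p_star \<kappa> b < p \<Longrightarrow> c < b * p"
        using assms(2) by (simp_all add: p_star field_simps)
      moreover have "a p (successes \<kappa> (b * p) 1) = b * p"
        using a_typ[OF p] by (simp add: s_typ_successes)
      ultimately show ?case using cmp c(4)[OF l] c(5)[of "b * p"] by metis
    qed
  next
    fix s assume "2 \<le> \<kappa>" and s: "s \<in> {0..p_star \<kappa> b * b} - {s_typ \<kappa> b (p_star \<kappa> b)}"
    then have c\<kappa>: "c < real \<kappa>" using c(2) by simp
    have bp: "b * p_star \<kappa> b = c" and p0: "0 < p_star \<kappa> b" using assms(2) c(1) by (auto simp: p_star)
    have "0 \<le> s" "s < real \<kappa>" using s c\<kappa> bp by (auto simp: mult.commute)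
    then obtain x where x: "0 \<le> x" "successes \<kappa> c x = s" using successes_surj[OF c(1)] by blast
    then have "x \<noteq> 1" using s by (auto simp: s_typ_successes bp)
    then have "c < attempts \<kappa> c x"
      using excess_pos_critical[OF c(1) c\<kappa> c(3) x(1)] excess_sign(1)[OF c(1) x(1)] by simp
    then show "a (p_star \<kappa> b) s > a (p_star \<kappa> b) (s_typ \<kappa> b (p_star \<kappa> b))"
      using a_typ[OF p0] a_eq[OF p0 x(1)] x(2) by (simp add: bp)
  qed
qed

end
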